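(* Suppose $\mathfrak{Q}=(Q,+,\cdot,\le)$ is an ordered field and $G$ is a group (under composition) for which: (i) $\mathrm{Triv}^{\uparrow}_{\mathfrak{Q}}<G\le\mathrm{Sym}(Q^4)$; (ii) for every $g\in G$, $g[\mathbf{t}]$ is a line of finite slope; (iii) if $g\in G$ takes vertical lines to vertical lines, then $g\in\mathrm{Triv}^{\uparrow}_{\mathfrak{Q}}$. Then the model $\mathfrak{M}(G)$ satisfies all of Borisov's Axioms (BA1–BA4 and Axioms I–IV). Furthermore, $\mathbb{W}_{\mathfrak{M}(G)}=G$.
   Context: $H\le G$ means subgroup, $H<G$ proper subgroup; $\mathrm{Sym}(Q^4)$ is the group of all bijections of $Q^4$; $\mathbf{t}=\{(t,0,0,0):t\in Q\}$ is the time-axis. Models. A model is $\mathfrak{M}=\langle Ev,IM,IOb,Q,+,\cdot,\le,C,P\rangle$ with nonempty sets $Ev$ (events), $IM$ (inertial motions), $IOb$ (inertial observers), quantities $\mathfrak{Q}=(Q,+,\cdot,\le)$, and relations $C\subseteq IOb\times Ev\times Q^4$, $P\subseteq IM\times Ev$. For $k\in IOb$ let $C_k=\{(e,\vec p):C(k,e,\vec p)\}$; when all $C_k$ are bijections $Ev\to Q^4$, put $f_{kh}=C_k\circ C_h^{-1}:Q^4\to Q^4$ (worldview transformation), $\mathrm{wl}_k(i)=C_k[\{e\in Ev: P(i,e)\}]$ (worldline of $i$ according to $k$), and $\mathbb{W}_{\mathfrak{M}}=\{f_{kh}:k,h\in IOb\}$. Given $G\subseteq\mathrm{Sym}(Q^4)$,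 the model $\mathfrak{M}(G)$ is defined by $Ev=Q^4$, $IM=\{g[\mathbf{t}]:g\in G\}$, $IOb=G$, $C(k,e,\vec p)\iff k(e)=\vec p$, $P(i,e)\iff e\in i$, with quantity structure $\mathfrak{Q}$. For $\vec p=(p_0,p_1,p_2,p_3)\in Q^4$, $p_t=p_0$ and $\vec p_s=(p_1,p_2,p_3)$. A line is a set $\{\vec p+\lambda\vec v:\lambda\in Q\}$ with $\vec v\ne 0$; it is vertical if $\vec p_s=\vec q_s$ for all its points $\vec p,\vec q$, and of finite slope if it has points $\vec p,\vec q$ with $p_t\neq q_t$. Motion $i$ is stationary w.r.t. $k$ if $\mathrm{wl}_k(i)$ is a vertical line; $h$ is at rest w.r.t. $k$ if every $i\in IM$ stationary w.r.t. $h$ is stationary w.r.t. $k$. A trivial transformation is a composition of a translation and a linear map $Q^4\to Q^4$ preserving the usual scalar product, which takes vertical lines to vertical lines. $T:Q^4\to Q^4$ is orthochronous if $T(1,0,0,0)_t>T(0,0,0,0)_t$. $\mathrm{Triv}^{\uparrow}_{\mathfrak{Q}}$ is the set (group) of orthochronous trivial transformations. Borisov's Axioms are: BA1: $\mathfrak{Q}$ is an ordered field. BA2: for every $k\in IOb$, $C_k$ is a bijection $Ev\to Q^4$. BA3: for every vertical line $\ell$ and $k\in IOb$ there is $i\in IM$ with $\mathrm{wl}_k(i)=\ell$. BA4: for all $i\in IM$, $k\in IOb$, $\mathrm{wl}_k(i)$ is a line of finite slope. Axiom I: there are $k,h\in IOb$ with $h$ not at rest w.r.t. $k$. Axiom II: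 (a) for all $k\in IOb$ and $\varphi\in\mathrm{Triv}^{\uparrow}_{\mathfrak{Q}}$ there is $h\in IOb$ with $f_{kh}=\varphi$; (b) for all $k,h\in IOb$, if $h$ is at rest w.r.t. $k$ then $f_{kh}\in\mathrm{Triv}^{\uparrow}_{\mathfrak{Q}}$. Axiom III: for all $i\in IM$, $k\in IOb$, $\varphi\in\mathrm{Triv}^{\uparrow}_{\mathfrak{Q}}$ there is $i'\in IM$ with $\mathrm{wl}_k(i')=\varphi[\mathrm{wl}_k(i)]$. Axiom IV: for all $k,k',h\in IOb$ there is $h'\in IOb$ with $f_{hh'}=f_{kk'}$. *)

theory Defs
  imports "HOL-Analysis.Analysis" "HOL-Algebra.Bij"
begin

text \<open>
  The quantity structure (Q, +, *, <=) of a model is the type \<open>'q\<close> with its operations. Definitions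
  only assume the bare operations on \<open>'q\<close>, so that being an ordered field is an axiom about a model
  and is not enforced by its type.

  Points of the four-dimensional coordinate space have type \<open>'q ^ 4\<close>, with the time component at index 0 and the
  spatial components at 1, 2, 3. In the index type \<open>4\<close> the numeral 4 denotes 0, so library
  facts such as \<open>forall_4\<close> and \<open>UNIV_4\<close> write 4 for the time index.
\<close>

definition is_ordered_field :: "'q::{zero,one,plus,times,ord} itself \<Rightarrow> bool" where
  "is_ordered_field _ \<longleftrightarrow>
     (\<forall>a b c :: 'q. (a + b) + c = a + (b + c)) \<and>
     (\<forall>a b :: 'q. a + b = b + a) \<and>
     (\<forall>a :: 'q. 0 + a = a) \<and>
     (\<forall>a :: 'q. \<exists>b. a + b = 0) \<and>
     (\<forall>a b c :: 'q. (a * b) * c = a * (b * c)) \<and>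
     (\<forall>a b :: 'q. a * b = b * a) \<and>
     (\<forall>a :: 'q. 1 * a = a) \<and>
     (\<forall>a :: 'q. a \<noteq> 0 \<longrightarrow> (\<exists>b. a * b = 1)) \<and>
     (0 :: 'q) \<noteq> 1 \<and>
     (\<forall>a b c :: 'q. a * (b + c) = a * b + a * c) \<and>
     class.linorder ((\<le>) :: 'q \<Rightarrow> 'q \<Rightarrow> bool) (<) \<and>
     (\<forall>a b c :: 'q. a \<le> b \<longrightarrow> a + c \<le> b + c) \<and>
     (\<forall>a b :: 'q. 0 \<le> a \<and> 0 \<le> b \<longrightarrow> 0 \<le> a * b)"

definition spatial :: "'q ^ 4 \<Rightarrow> 'q \<times> 'q \<times> 'q" where
  "spatial p = (p $ 1, p $ 2, p $ 3)"

definition time_point :: "'q::zero \<Rightarrow> 'q ^ 4" where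
  "time_point t = (\<chi> i. if i = 0 then t else 0)"

definition time_axis :: "('q::zero ^ 4) set" where
  "time_axis = range time_point"

definition is_line :: "('q::{zero,plus,times} ^ 4) set \<Rightarrow> bool" where
  "is_line l \<longleftrightarrow> (\<exists>p v. v \<noteq> 0 \<and> l = {p + c *s v | c. True})"

definition vertical_line :: "('q::{zero,plus,times} ^ 4) set \<Rightarrow> bool" where
  "vertical_line l \<longleftrightarrow> is_line l \<and> (\<forall>p\<in>l. \<forall>q\<in>l. spatial p = spatial q)"

definition finite_slope_line :: "('q::{zero,plus,times} ^ 4) set \<Rightarrow> bool" where
  "finite_slope_line l \<longleftrightarrow> is_line l \<and> (\<exists>p\<in>l. \<exists>q\<in>l. p $ 0 \<noteq> q $ 0)"

definition preserves_vertical :: "('q::{zero,plus,times} ^ 4 \<Rightarrow> 'q ^ 4) \<Rightarrow> bool" where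
  "preserves_vertical f \<longleftrightarrow> (\<forall>l. vertical_line l \<longrightarrow> vertical_line (f ` l))"

text \<open>
  The library's \<open>linear\<close> and its scalar product are only available over richer structures.
\<close>

definition linear_map :: "('q::{plus,times} ^ 4 \<Rightarrow> 'q ^ 4) \<Rightarrow> bool" where
  "linear_map L \<longleftrightarrow> (\<forall>u v. L (u + v) = L u + L v) \<and> (\<forall>c v. L (c *s v) = c *s L v)"

definition scalar_prod :: "'q::{plus,times} ^ 4 \<Rightarrow> 'q ^ 4 \<Rightarrow> 'q" where
  "scalar_prod u v = u $ 0 * v $ 0 + u $ 1 * v $ 1 + u $ 2 * v $ 2 + u $ 3 * v $ 3"

definition trivial_transformation :: "('q::{zero,plus,times} ^ 4 \<Rightarrow> 'q ^ 4) \<Rightarrow> bool" where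
  "trivial_transformation T \<longleftrightarrow>
     (\<exists>a L. linear_map L \<and> (\<forall>u v. scalar_prod (L u) (L v) = scalar_prod u v) \<and>
            T = (\<lambda>p. p + a) \<circ> L) \<and>
     preserves_vertical T"

definition orthochronous :: "('q::{zero,one,ord} ^ 4 \<Rightarrow> 'q ^ 4) \<Rightarrow> bool" where
  "orthochronous T \<longleftrightarrow> T (time_point 1) $ 0 > T (time_point 0) $ 0"

definition Triv_up :: "('q::{zero,one,plus,times,ord} ^ 4 \<Rightarrow> 'q ^ 4) set" where
  "Triv_up = {T. trivial_transformation T \<and> orthochronous T}"

record ('e, 'i, 'o, 'q) kinematic_model =
  Ev :: "'e set"
  IM :: "'i set"
  IOb :: "'o set"
  Crd :: "('o \<times> 'e \<times> ('q ^ 4)) set"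
  Part :: "('i \<times> 'e) set"

definition is_model :: "('e, 'i, 'o, 'q) kinematic_model \<Rightarrow> bool" where
  "is_model M \<longleftrightarrow> Ev M \<noteq> {} \<and> IM M \<noteq> {} \<and> IOb M \<noteq> {} \<and>
     Crd M \<subseteq> IOb M \<times> Ev M \<times> UNIV \<and> Part M \<subseteq> IM M \<times> Ev M"

definition crd_rel :: "('e, 'i, 'o, 'q) kinematic_model \<Rightarrow> 'o \<Rightarrow> ('e \<times> ('q ^ 4)) set" where
  "crd_rel M k = {(e, p). (k, e, p) \<in> Crd M}"

text \<open>
  The worldview transformation is meaningful when the coordinatizations are bijections. In a
  relational composition \<open>r O s\<close>, the relation \<open>r\<close> is applied first.
\<close>

definition worldview :: "('e, 'i, 'o, 'q) kinematic_model \<Rightarrow> 'o \<Rightarrow> 'o \<Rightarrow> 'q ^ 4 \<Rightarrow> 'q ^ 4" where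
  "worldview M k h p = (THE q. (p, q) \<in> (crd_rel M h)\<inverse> O crd_rel M k)"

definition wl :: "('e, 'i, 'o, 'q) kinematic_model \<Rightarrow> 'o \<Rightarrow> 'i \<Rightarrow> ('q ^ 4) set" where
  "wl M k i = crd_rel M k `` {e \<in> Ev M. (i, e) \<in> Part M}"

definition worldview_transformations ::
    "('e, 'i, 'o, 'q) kinematic_model \<Rightarrow> ('q ^ 4 \<Rightarrow> 'q ^ 4) set" where
  "worldview_transformations M = {worldview M k h | k h. k \<in> IOb M \<and> h \<in> IOb M}"

definition stationary ::
    "('e, 'i, 'o, 'q::{zero,plus,times}) kinematic_model \<Rightarrow> 'i \<Rightarrow> 'o \<Rightarrow> bool" where
  "stationary M i k \<longleftrightarrow> vertical_line (wl M k i)"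

text \<open>\<open>at_rest M h k\<close>: observer \<open>h\<close> is at rest with respect to \<open>k\<close>.\<close>

definition at_rest ::
    "('e, 'i, 'o, 'q::{zero,plus,times}) kinematic_model \<Rightarrow> 'o \<Rightarrow> 'o \<Rightarrow> bool" where
  "at_rest M h k \<longleftrightarrow> (\<forall>i \<in> IM M. stationary M i h \<longrightarrow> stationary M i k)"

definition BA1 :: "('e, 'i, 'o, 'q::{zero,one,plus,times,ord}) kinematic_model \<Rightarrow> bool" where
  "BA1 M \<longleftrightarrow> is_ordered_field TYPE('q)"

definition BA2 :: "('e, 'i, 'o, 'q) kinematic_model \<Rightarrow> bool" where
  "BA2 M \<longleftrightarrow> (\<forall>k \<in> IOb M. \<exists>f. bij_betw f (Ev M) UNIV \<and> crd_rel M k = {(e, f e) | e. e \<in> Ev M})"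

definition BA3 :: "('e, 'i, 'o, 'q::{zero,plus,times}) kinematic_model \<Rightarrow> bool" where
  "BA3 M \<longleftrightarrow> (\<forall>l. \<forall>k \<in> IOb M. vertical_line l \<longrightarrow> (\<exists>i \<in> IM M. wl M k i = l))"

definition BA4 :: "('e, 'i, 'o, 'q::{zero,plus,times}) kinematic_model \<Rightarrow> bool" where
  "BA4 M \<longleftrightarrow> (\<forall>i \<in> IM M. \<forall>k \<in> IOb M. finite_slope_line (wl M k i))"

definition AxI :: "('e, 'i, 'o, 'q::{zero,plus,times}) kinematic_model \<Rightarrow> bool" where
  "AxI M \<longleftrightarrow> (\<exists>k \<in> IOb M. \<exists>h \<in> IOb M. \<not> at_rest M h k)"

definition AxII :: "('e, 'i, 'o, 'q::{zero,one,plus,times,ord}) kinematic_model \<Rightarrow> bool" where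
  "AxII M \<longleftrightarrow>
     (\<forall>k \<in> IOb M. \<forall>\<phi> \<in> Triv_up. \<exists>h \<in> IOb M. worldview M k h = \<phi>) \<and>
     (\<forall>k \<in> IOb M. \<forall>h \<in> IOb M. at_rest M h k \<longrightarrow> worldview M k h \<in> Triv_up)"

definition AxIII :: "('e, 'i, 'o, 'q::{zero,one,plus,times,ord}) kinematic_model \<Rightarrow> bool" where
  "AxIII M \<longleftrightarrow>
     (\<forall>i \<in> IM M. \<forall>k \<in> IOb M. \<forall>\<phi> \<in> Triv_up. \<exists>i' \<in> IM M. wl M k i' = \<phi> ` wl M k i)"

definition AxIV :: "('e, 'i, 'o, 'q) kinematic_model \<Rightarrow> bool" where
  "AxIV M \<longleftrightarrow>
     (\<forall>k \<in> IOb M. \<forall>k' \<in> IOb M. \<forall>h \<in> IOb M. \<exists>h' \<in> IOb M. worldview M h h' = worldview M k k')"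

definition group_model ::
    "('q::zero ^ 4 \<Rightarrow> 'q ^ 4) set \<Rightarrow> ('q ^ 4, ('q ^ 4) set, 'q ^ 4 \<Rightarrow> 'q ^ 4, 'q) kinematic_model" where
  "group_model G =
     \<lparr> Ev = UNIV,
       IM = {g ` time_axis | g. g \<in> G},
       IOb = G,
       Crd = {(k, e, p). k \<in> G \<and> k e = p},
       Part = {(i, e). i \<in> {g ` time_axis | g. g \<in> G} \<and> e \<in> i} \<rparr>"

end

theory Submission
  imports Defs
begin

text \<open>
  The worldline of \<open>i\<close> according to \<open>k\<close> is \<open>k ` i\<close>, and the worldview transformation from \<open>h\<close> to
  \<open>k\<close> is \<open>k \<circ> h'\<close> with \<open>h'\<close> the inverse of \<open>h\<close>; so most axioms express that \<open>G\<close> is a group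
  containing \<open>Triv_up\<close>. Since \<open>Triv_up\<close> contains the translations, every vertical line is a worldline
  for every observer; hence if \<open>h\<close> is at rest with respect to \<open>k\<close>, then \<open>k \<circ> h'\<close> preserves
  verticality and therefore lies in \<open>Triv_up\<close>. Consequently the observer \<open>id\<close> is not at rest with
  respect to any \<open>k \<in> G - Triv_up\<close>.
\<close>

text \<open>This settles BA1, which is phrased for bare operations, from the class assumption on
  \<open>'q\<close>.\<close>

lemma is_ordered_field_linordered_field: "is_ordered_field TYPE('q::linordered_field)"
proof -
  have "\<exists>b. a + b = 0" for a :: 'q
    by (rule exI[of _ "- a"]) simp
  moreover have "a \<noteq> 0 \<longrightarrow> (\<exists>b. a * b = 1)" for a :: 'q
    by (auto intro: exI[of _ "inverse a"])
  moreover have "class.linorder ((\<le>) :: 'q \<Rightarrow> 'q \<Rightarrow> bool) (<)"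
    by (rule linorder_class.linorder_axioms)
  ultimately show ?thesis
    unfolding is_ordered_field_def by (simp add: algebra_simps)
qed

text \<open>The operations of \<open>BijGroup\<close> are restricted composition and restricted
  inverse; over \<open>UNIV\<close> the restrictions vanish, so \<open>G\<close> can be handled with
  plain \<open>comp\<close> and \<open>inv_into\<close>.\<close>

lemma subgroup_BijGroup_UNIV:
  assumes "subgroup G (BijGroup UNIV)"
  shows "g \<in> G \<Longrightarrow> bij g"
    and "g \<in> G \<Longrightarrow> h \<in> G \<Longrightarrow> g \<circ> h \<in> G"
    and "g \<in> G \<Longrightarrow> inv_into UNIV g \<in> G"
    and "id \<in> G"
proof -
  have Bij: "g \<in> Bij UNIV" if "g \<in> G" for g
    using subgroup.mem_carrier[OF assms that] by (simp add: BijGroup_def)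
  show "bij g" if "g \<in> G" for g
    using Bij[OF that] by (simp add: Bij_def)
  show "g \<circ> h \<in> G" if "g \<in> G" "h \<in> G" for g h
    using subgroup.m_closed[OF assms that] Bij[OF that(1)] Bij[OF that(2)]
    by (simp add: BijGroup_def compose_def comp_def restrict_UNIV)
  show "inv_into UNIV g \<in> G" if "g \<in> G" for g
    using subgroup.m_inv_closed[OF assms that] inv_BijGroup[OF Bij[OF that]] by (simp add: restrict_UNIV)
  show "id \<in> G"
    using subgroup.one_closed[OF assms] by (simp add: BijGroup_def id_def restrict_UNIV)
qed

lemma index_4: "(4 :: 4) = 0"
  by simp

text \<open>The direction \<open>v\<close> of a vertical line has zero spatial part and hence
  nonzero time part, so division by \<open>v $ 0\<close> reparametrizes the line by time. Motions
  are images of the time axis, so vertical lines are needed in that form.\<close>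

lemma translation_time_axis_eq_vertical_line:
  fixes l :: "('q::field ^ 4) set"
  assumes "vertical_line l"
  obtains p where "l = (\<lambda>x. x + p) ` time_axis"
proof -
  from assms obtain p v where v: "v \<noteq> 0" and l: "l = {p + c *s v | c. True}"
    and sp: "\<And>x y. x \<in> l \<Longrightarrow> y \<in> l \<Longrightarrow> spatial x = spatial y"
    unfolding vertical_line_def is_line_def by blast
  \<comment> \<open>Comparing the points with parameters 0 and 1 isolates the spatial part of
    \<open>v\<close>.\<close>
  have "p \<in> l" "p + v \<in> l"
    unfolding l by (auto intro: exI[of _ 0] exI[of _ 1])
  from sp[OF this] have v_spatial: "v $ 1 = 0" "v $ 2 = 0" "v $ 3 = 0"
    by (auto simp: spatial_def)
  with v have v0: "v $ 0 \<noteq> 0"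
    by (simp add: vec_eq_iff forall_4 index_4)
  have scale: "c *s v = time_point (c * v $ 0)" for c
    using v_spatial by (simp add: vec_eq_iff forall_4 index_4 time_point_def)
  have "l = (\<lambda>x. x + p) ` time_axis"
  proof (intro equalityI subsetI)
    fix x assume "x \<in> l"
    then show "x \<in> (\<lambda>x. x + p) ` time_axis"
      unfolding l scale time_axis_def by (auto simp: add.commute)
  next
    fix x assume "x \<in> (\<lambda>x. x + p) ` time_axis"
    then obtain t where "x = time_point t + p"
      unfolding time_axis_def by auto
    then have "x = p + (t / v $ 0) *s v"
      using v0 by (simp add: scale add.commute)
    then show "x \<in> l"
      unfolding l by blast
  qed
  then show ?thesis ..
qed

lemma preserves_vertical_translation:
  "preserves_vertical (\<lambda>x :: 'q::linordered_field ^ 4. x + a)"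
  unfolding preserves_vertical_def
proof (intro allI impI)
  fix l :: "('q ^ 4) set"
  assume l: "vertical_line l"
  then obtain p v where v: "v \<noteq> 0" "l = {p + c *s v | c. True}"
    unfolding vertical_line_def is_line_def by blast
  then have "(\<lambda>x. x + a) ` l = {(p + a) + c *s v | c. True}"
    by (force simp: add_ac)
  then have "is_line ((\<lambda>x. x + a) ` l)"
    unfolding is_line_def using v(1) by blast
  moreover have "spatial (x + a) = spatial (y + a)" if "x \<in> l" "y \<in> l" for x y
  proof -
    from l that have "spatial x = spatial y"
      unfolding vertical_line_def by blast
    then show ?thesis
      by (simp add: spatial_def)
  qed
  ultimately show "vertical_line ((\<lambda>x. x + a) ` l)"
    unfolding vertical_line_def by blast
qed

lemma translation_in_Triv_up: "(\<lambda>x :: 'q::linordered_field ^ 4. x + a) \<in> Triv_up"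
proof -
  have "trivial_transformation (\<lambda>x. x + a)"
    unfolding trivial_transformation_def
    using preserves_vertical_translation
    by (auto simp: linear_map_def intro!: exI[of _ a] exI[of _ id])
  moreover have "orthochronous (\<lambda>x. x + a)"
    by (simp add: orthochronous_def time_point_def)
  ultimately show ?thesis
    by (simp add: Triv_up_def)
qed

lemma IM_group_model: "IM (group_model G) = {g ` time_axis | g. g \<in> G}"
  by (simp add: group_model_def)

lemma IOb_group_model: "IOb (group_model G) = G"
  by (simp add: group_model_def)

lemma Ev_group_model: "Ev (group_model G) = UNIV"
  by (simp add: group_model_def)

lemma crd_rel_group_model: "k \<in> G \<Longrightarrow> crd_rel (group_model G) k = {(e, k e) | e. True}"
  by (auto simp: crd_rel_def group_model_def)

text \<open>Observer \<open>k\<close> coordinatizes events by the map \<open>k\<close> itself. For a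
  group \<open>G\<close> the right side is again the image of the time axis under an element of
  \<open>G\<close>.\<close>

lemma wl_group_model:
  assumes "k \<in> G" "g \<in> G"
  shows "wl (group_model G) k (g ` time_axis) = (k \<circ> g) ` time_axis"
proof -
  have "{e \<in> Ev (group_model G). (g ` time_axis, e) \<in> Part (group_model G)} = g ` time_axis"
    using assms(2) by (auto simp: group_model_def)
  then show ?thesis
    using assms(1) by (force simp: wl_def crd_rel_group_model)
qed

text \<open>Bijectivity of \<open>h\<close> leaves exactly one event with
  \<open>h\<close>-coordinates \<open>p\<close>, so the description in \<open>worldview\<close>
  denotes.\<close>

lemma worldview_group_model:
  assumes "k \<in> G" "h \<in> G" "bij h"
  shows "worldview (group_model G) k h = k \<circ> inv_into UNIV h"
proof
  fix p
  have "(p, q) \<in> (crd_rel (group_model G) h)\<inverse> O crd_rel (group_model G) k \<longleftrightarrow>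
      (\<exists>e. e = inv_into UNIV h p \<and> q = k e)" for q
    unfolding bij_inv_eq_iff[OF assms(3)]
    using assms(1,2) by (auto simp: crd_rel_group_model relcomp_unfold)
  then show "worldview (group_model G) k h p = (k \<circ> inv_into UNIV h) p"
    by (simp add: worldview_def)
qed

theorem theorem12:
  fixes G :: "('q::linordered_field ^ 4 \<Rightarrow> 'q ^ 4) set"
  assumes "subgroup G (BijGroup UNIV)"
    and "subgroup Triv_up ((BijGroup UNIV)\<lparr>carrier := G\<rparr>)" and "Triv_up \<noteq> G"
    and "\<And>g. g \<in> G \<Longrightarrow> finite_slope_line (g ` time_axis)"
    and "\<And>g. g \<in> G \<Longrightarrow> preserves_vertical g \<Longrightarrow> g \<in> Triv_up"
  shows "is_model (group_model G) \<and>
    BA1 (group_model G) \<and> BA2 (group_model G) \<and> BA3 (group_model G) \<and> BA4 (group_model G) \<and>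
    AxI (group_model G) \<and> AxII (group_model G) \<and> AxIII (group_model G) \<and> AxIV (group_model G) \<and>
    worldview_transformations (group_model G) = G"
proof -
  let ?M = "group_model G"
  note G = subgroup_BijGroup_UNIV[OF assms(1)]
  have Triv_G: "Triv_up \<subseteq> G"
    using subgroup.subset[OF assms(2)] by simp
  have worldview: "worldview ?M k h = k \<circ> inv_into UNIV h" if "k \<in> G" "h \<in> G" for k h
    using worldview_group_model[OF that] G(1) that by blast
  \<comment> \<open>The first equation verifies the motion with a prescribed worldline for
    \<open>k\<close>, the second the observer with a prescribed worldview transformation to
    \<open>k\<close>.\<close>
  have cancel: "k \<circ> (inv_into UNIV k \<circ> f) = f" "k \<circ> inv_into UNIV (inv_into UNIV f \<circ> k) = f"
    if "k \<in> G" "f \<in> G" for k f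
  proof -
    have k: "k \<circ> inv_into UNIV k = id" and f: "bij f" "bij k" "bij (inv_into UNIV f)"
      using G(1,3) that by (auto simp: bij_is_surj surj_iff[symmetric])
    show "k \<circ> (inv_into UNIV k \<circ> f) = f"
      by (simp add: comp_assoc[symmetric] k)
    show "k \<circ> inv_into UNIV (inv_into UNIV f \<circ> k) = f"
      by (simp add: o_inv_distrib f inv_inv_eq comp_assoc[symmetric] k)
  qed
  \<comment> \<open>Pulling the line back along \<open>k\<close> gives the motion. BA3 uses this
    with \<open>g\<close> a translation, Axiom III with a composite.\<close>
  have IM_wl: "\<exists>i \<in> IM ?M. wl ?M k i = g ` time_axis" if "k \<in> G" "g \<in> G" for k g
  proof
    show "(inv_into UNIV k \<circ> g) ` time_axis \<in> IM ?M"
      unfolding IM_group_model using G that by blast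
    show "wl ?M k ((inv_into UNIV k \<circ> g) ` time_axis) = g ` time_axis"
      using wl_group_model[of k G "inv_into UNIV k \<circ> g"] G that by (simp add: cancel)
  qed
  have ba3: "BA3 ?M"
    unfolding BA3_def IOb_group_model
  proof (intro allI ballI impI)
    fix l :: "('q ^ 4) set" and k
    assume "k \<in> G" "vertical_line l"
    from translation_time_axis_eq_vertical_line[OF this(2)]
    obtain p where "l = (\<lambda>x. x + p) ` time_axis" .
    then show "\<exists>i\<in>IM ?M. wl ?M k i = l"
      using IM_wl[OF \<open>k \<in> G\<close>] translation_in_Triv_up Triv_G by blast
  qed
  have at_rest: "k \<circ> inv_into UNIV h \<in> Triv_up" if kh: "k \<in> G" "h \<in> G" and rest: "at_rest ?M h k" for k h
  proof (rule assms(5))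
    show "k \<circ> inv_into UNIV h \<in> G"
      using G kh by blast
    show "preserves_vertical (k \<circ> inv_into UNIV h)"
      unfolding preserves_vertical_def
    proof (intro allI impI)
      fix l :: "('q ^ 4) set"
      assume l: "vertical_line l"
      with ba3 kh obtain i where i: "i \<in> IM ?M" "wl ?M h i = l"
        unfolding BA3_def IOb_group_model by blast
      then obtain g where g: "g \<in> G" "i = g ` time_axis"
        by (auto simp: IM_group_model)
      have "vertical_line (wl ?M k i)"
        using rest i l by (auto simp: at_rest_def stationary_def)
      \<comment> \<open>As a set of events, \<open>i\<close> is the preimage of \<open>l\<close>
        under \<open>h\<close>; applying \<open>k\<close> to it gives the worldline for
        \<open>k\<close>.\<close>
      moreover have "wl ?M k i = (k \<circ> inv_into UNIV h) ` l"
      proof -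
        have "l = h ` g ` time_axis"
          using wl_group_model[OF kh(2) g(1)] i(2) g(2) by (simp add: image_comp)
        then have "inv_into UNIV h ` l = g ` time_axis"
          using image_inv_f_f[OF bij_is_inj[OF G(1)[OF kh(2)]]] by simp
        then show ?thesis
          using wl_group_model[OF kh(1) g(1)] g(2) by (metis image_comp)
      qed
      ultimately show "vertical_line ((k \<circ> inv_into UNIV h) ` l)"
        by simp
    qed
  qed
  \<comment> \<open>Solving \<open>k \<circ> inv_into UNIV h = f\<close> for \<open>h\<close> gives
    the witness. Allowing every \<open>f\<close> in \<open>G\<close> serves Axiom II(a), Axiom IV
    and the final equality alike.\<close>
  have worldview_onto: "\<exists>h\<in>G. worldview ?M k h = f" if "k \<in> G" "f \<in> G" for k f
  proof
    show h: "inv_into UNIV f \<circ> k \<in> G"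
      using G that by blast
    show "worldview ?M k (inv_into UNIV f \<circ> k) = f"
      using worldview[OF that(1) h] cancel(2)[OF that] by (rule trans)
  qed
  have worldview_in: "worldview ?M k h \<in> G" if "k \<in> G" "h \<in> G" for k h
    using worldview[OF that] G(2)[OF that(1) G(3)[OF that(2)]] by simp
  have "is_model ?M"
    using G(4) by (auto simp: is_model_def group_model_def)
  moreover have "BA1 ?M"
    unfolding BA1_def by (rule is_ordered_field_linordered_field)
  moreover have "BA2 ?M"
    using G(1) by (auto simp: BA2_def IOb_group_model Ev_group_model crd_rel_group_model)
  moreover have "BA4 ?M"
    unfolding BA4_def IOb_group_model
  proof (intro ballI)
    fix i k
    assume "i \<in> IM ?M" and k: "k \<in> G"
    then obtain g where g: "g \<in> G" "i = g ` time_axis"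
      by (auto simp: IM_group_model)
    then show "finite_slope_line (wl ?M k i)"
      using assms(4)[OF G(2)[OF k g(1)]] wl_group_model[OF k g(1)] by simp
  qed
  moreover have "AxI ?M"
  proof -
    from assms(3) Triv_G obtain g where "g \<in> G" "g \<notin> Triv_up"
      by blast
    then show ?thesis
      using at_rest[of g id] G(4) by (fastforce simp: AxI_def IOb_group_model)
  qed
  moreover have "AxII ?M"
    unfolding AxII_def IOb_group_model
  proof (intro conjI ballI impI)
    show "\<exists>h\<in>G. worldview ?M k h = \<phi>" if "k \<in> G" "\<phi> \<in> Triv_up" for k \<phi>
      using worldview_onto that Triv_G by blast
    show "worldview ?M k h \<in> Triv_up" if "k \<in> G" "h \<in> G" "at_rest ?M h k" for k h
      using at_rest[OF that] worldview[OF that(1,2)] by simp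
  qed
  moreover have "AxIII ?M"
    unfolding AxIII_def IOb_group_model
  proof (intro ballI)
    fix i k and \<phi> :: "'q ^ 4 \<Rightarrow> 'q ^ 4"
    assume i: "i \<in> IM ?M" and k: "k \<in> G" and "\<phi> \<in> Triv_up"
    from i obtain g where g: "g \<in> G" "i = g ` time_axis"
      by (auto simp: IM_group_model)
    \<comment> \<open>This element carries the time axis to the required worldline, the image under
      \<open>\<phi>\<close> of the worldline of \<open>i\<close>.\<close>
    have "\<phi> \<circ> (k \<circ> g) \<in> G"
      using G(2) k g(1) \<open>\<phi> \<in> Triv_up\<close> Triv_G by (metis subsetD)
    from IM_wl[OF k this] show "\<exists>i'\<in>IM ?M. wl ?M k i' = \<phi> ` wl ?M k i"
      unfolding g(2) wl_group_model[OF k g(1)] image_comp .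
  qed
  \<comment> \<open>The transformation from \<open>k'\<close> to \<open>k\<close> lies in
    \<open>G\<close>, so it is also attained with \<open>h\<close> in place of
    \<open>k\<close>.\<close>
  moreover have "AxIV ?M"
    unfolding AxIV_def IOb_group_model
    using worldview_in worldview_onto by blast
  moreover have "worldview_transformations ?M = G"
    unfolding worldview_transformations_def IOb_group_model
  proof (intro equalityI subsetI)
    fix f assume "f \<in> {worldview ?M k h | k h. k \<in> G \<and> h \<in> G}"
    then show "f \<in> G"
      using worldview_in by blast
  next
    fix f assume "f \<in> G"
    with worldview_onto[OF G(4)] obtain h where "h \<in> G" "worldview ?M id h = f"
      by blast
    with G(4) show "f \<in> {worldview ?M k h | k h. k \<in> G \<and> h \<in> G}"
      by blast
  qed
  ultimately show ?thesis
    using ba3 by blast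
qed

end
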